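(* Let $\Delta$ be a simplicial complex of dimension $d$ over $[n]$. Then $\Delta$ is shellable if and only if its facet ideal $I_{\mathcal{F}}(\Delta)$ has linear residuals.
   Context: A simplicial complex $\Delta$ over $[n]=\{1,\dots,n\}$ is a collection of subsets of $[n]$ closed under taking subsets. Its members are faces, its maximal faces under inclusion are facets, $\dim F=|F|-1$ for a face $F$, and $\dim\Delta$ is the maximum dimension of a facet. $\Delta=\langle F_1,\dots,F_s\rangle$ denotes the simplicial complex with facets $F_1,\dots,F_s$. A simplicial complex is pure of dimension $d$ if all its facets have dimension $d$. $\Delta$ is not assumed pure. Shellable (in the possibly non-pure sense of Björner and Wachs): $\Delta$ is shellable if its facets can be ordered $F_1,\dots,F_s$ such that for all $2\le j\le s$ the complex $\langle F_1,\dots,F_{j-1}\rangle\cap\langle F_j\rangle$ is pure of dimension $\dim(F_j)-1$. Facet ideal: let $S=k[x_1,\dots,x_n]$ be the polynomial ring over an infinite field $k$. If $F_1,\dots,F_s$ are the facets of $\Delta$, then $I_{\mathcal{F}}(\Delta)\subset S$ is the ideal minimally generated by the square-free monomials $m_{F_1},\dots,m_{F_s}$, where $m_{F}=\prod_{i\in F}x_i$. Linear residuals: a monomial ideal $I\subset S$ has linear residuals if there is an ordering $m_1,\dots,m_r$ of its minimal monomial generators such that for every $1<i\le r$ the ideal generated by the set $\mathrm{Res}(I_i)=\{u_1,\dots,u_{i-1}\}$, where $u_k=\frac{m_i}{\gcd(m_k,m_i)}$ for $1\le k\le i-1$, is minimally generated by linear monomials (i.e. all its minimal monomial generators have degree $1$).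 *)

theory Defs
  imports "HOL-Algebra.Ideal" "HOL-Library.Poly_Mapping"
begin

section \<open>Simplicial complexes\<close>

definition simplicial_complex_on :: "nat \<Rightarrow> nat set set \<Rightarrow> bool" where
  "simplicial_complex_on n \<Delta> \<longleftrightarrow>
     \<Delta> \<subseteq> Pow {1..n} \<and> (\<forall>F\<in>\<Delta>. \<forall>G. G \<subseteq> F \<longrightarrow> G \<in> \<Delta>)"

definition facets :: "nat set set \<Rightarrow> nat set set" where
  "facets \<Delta> = {F \<in> \<Delta>. \<forall>G\<in>\<Delta>. F \<subseteq> G \<longrightarrow> G = F}"

text \<open>Dimensions are integers because the empty face has dimension \<open>-1\<close>.\<close>

definition face_dim :: "nat set \<Rightarrow> int" where
  "face_dim F = int (card F) - 1"

text \<open>Only meaningful if the complex has a facet; the void complex \<open>{}\<close> has no dimension,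
  and \<^const>\<open>Max\<close> is unspecified there.\<close>

definition complex_dim :: "nat set set \<Rightarrow> int" where
  "complex_dim \<Delta> = Max (face_dim ` facets \<Delta>)"

definition pure_of_dim :: "int \<Rightarrow> nat set set \<Rightarrow> bool" where
  "pure_of_dim d \<Delta> \<longleftrightarrow> (\<forall>F\<in>facets \<Delta>. face_dim F = d)"

definition generated_complex :: "nat set set \<Rightarrow> nat set set" where
  "generated_complex A = {G. \<exists>F\<in>A. G \<subseteq> F}"

text \<open>Non-pure shellability in the sense of Bjoerner and Wachs.  Lists are indexed from 0, so
  \<open>Fs ! j\<close> with \<open>1 \<le> j\<close> is the facet with number \<open>j + 1 \<ge> 2\<close>.\<close>

definition shellable :: "nat set set \<Rightarrow> bool" where
  "shellable \<Delta> \<longleftrightarrow>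
     (\<exists>Fs. distinct Fs \<and> set Fs = facets \<Delta> \<and>
        (\<forall>j. 1 \<le> j \<and> j < length Fs \<longrightarrow>
           pure_of_dim (face_dim (Fs ! j) - 1)
             (generated_complex (set (take j Fs)) \<inter> generated_complex {Fs ! j})))"


section \<open>The polynomial ring in the variables \<open>x\<^sub>1, \<dots>, x\<^sub>n\<close>\<close>

text \<open>A monomial is represented by its exponent vector, so that the product of monomials is the
  sum of exponent vectors, and a polynomial is a finitely supported map from exponent vectors to
  coefficients.  Variables are indexed by all natural numbers; the carrier of the ring below
  restricts them to \<open>{1..n}\<close>.\<close>

type_synonym expo = "nat \<Rightarrow>\<^sub>0 nat"
type_synonym 'k mpoly = "expo \<Rightarrow>\<^sub>0 'k"

definition expos :: "nat \<Rightarrow> expo set" where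
  "expos n = {a. Poly_Mapping.keys a \<subseteq> {1..n}}"

definition poly_ring :: "nat \<Rightarrow> 'k::field mpoly ring" where
  "poly_ring n = \<lparr>carrier = {p. Poly_Mapping.keys p \<subseteq> expos n}, mult = (*), one = 1, zero = 0, add = (+)\<rparr>"

definition monomial :: "expo \<Rightarrow> 'k::field mpoly" where
  "monomial a = Poly_Mapping.single a 1"

definition var :: "nat \<Rightarrow> 'k::field mpoly" where
  "var i = monomial (Poly_Mapping.single i 1)"

definition expo_degree :: "expo \<Rightarrow> nat" where
  "expo_degree a = (\<Sum>i\<in>Poly_Mapping.keys a. Poly_Mapping.lookup a i)"

lift_definition expo_gcd :: "expo \<Rightarrow> expo \<Rightarrow> expo" is "\<lambda>a b i. min (a i) (b i)"
  by (rule finite_subset[rotated], assumption) auto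

lemma expo_gcd_add_diff: "expo_gcd a b + (a - expo_gcd a b) = a"
  by (rule poly_mapping_eqI) (simp add: lookup_add lookup_minus expo_gcd.rep_eq)

lemma expo_gcd_greatest:
  "(\<exists>c'. expo_gcd a b = c + c') \<longleftrightarrow> (\<exists>a'. a = c + a') \<and> (\<exists>b'. b = c + b')"
proof -
  have *: "(\<exists>e'. e = c + e') \<longleftrightarrow> (\<forall>i. Poly_Mapping.lookup c i \<le> Poly_Mapping.lookup e i)" for e :: expo
  proof
    assume "\<forall>i. Poly_Mapping.lookup c i \<le> Poly_Mapping.lookup e i"
    then have "e = c + (e - c)"
      by (intro poly_mapping_eqI) (simp add: lookup_add lookup_minus)
    then show "\<exists>e'. e = c + e'" ..
  qed (auto simp: lookup_add)
  show ?thesis unfolding * by (auto simp: expo_gcd.rep_eq)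
qed

lemma monomial_add: "monomial (a + b) = monomial a * monomial b"
  by (simp add: monomial_def mult_single)

lemma cring_poly_ring: "cring (poly_ring n :: 'k::field mpoly ring)"
proof -
  let ?C = "{p :: 'k mpoly. Poly_Mapping.keys p \<subseteq> expos n}"
  have zero: "0 \<in> ?C" and one: "1 \<in> ?C"
    by (auto simp: expos_def)
  have add: "p + q \<in> ?C" if "p \<in> ?C" "q \<in> ?C" for p q
    using that keys_add[of p q] by blast
  have plus: "a + b \<in> expos n" if "a \<in> expos n" "b \<in> expos n" for a b
    using that keys_add[of a b] unfolding expos_def by blast
  have mult: "p * q \<in> ?C" if "p \<in> ?C" "q \<in> ?C" for p q
    using that keys_mult[of p q] plus by blast
  have uminus: "\<exists>q\<in>?C. p + q = 0" if "p \<in> ?C" for p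
    using that by (intro bexI[of _ "- p"]) (auto simp: in_keys_iff)
  have "abelian_group (poly_ring n :: 'k mpoly ring)"
    unfolding poly_ring_def
    by (rule abelian_groupI; simp only: ring.simps partial_object.simps)
       (simp_all only: zero add add.assoc add.commute add.left_commute add_0_left add_0_right uminus)
  moreover have "comm_monoid (poly_ring n :: 'k mpoly ring)"
    unfolding poly_ring_def
    by (rule comm_monoidI; simp only: monoid.simps partial_object.simps)
       (simp_all only: one mult mult.assoc mult.commute mult.left_commute mult_1_left mult_1_right)
  ultimately show ?thesis
    by (rule cringI) (simp add: poly_ring_def distrib_right)
qed


section \<open>Facet ideals and linear residuals\<close>

definition facet_ideal :: "nat \<Rightarrow> nat set set \<Rightarrow> 'k::field mpoly set" where
  "facet_ideal n \<Delta> = Idl\<^bsub>poly_ring n\<^esub> ((\<lambda>F. \<Prod>i\<in>F. var i) ` facets \<Delta>)"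

definition monomial_ideal_of :: "nat \<Rightarrow> expo set \<Rightarrow> 'k::field mpoly set" where
  "monomial_ideal_of n A = Idl\<^bsub>poly_ring n\<^esub> (monomial ` A)"

text \<open>A monomial ideal has exactly one minimal generating set consisting of monomials; its
  elements are the minimal monomial generators.\<close>

definition minimal_monomial_generators :: "nat \<Rightarrow> 'k::field mpoly set \<Rightarrow> expo set \<Rightarrow> bool" where
  "minimal_monomial_generators n I A \<longleftrightarrow>
     A \<subseteq> expos n \<and> I = monomial_ideal_of n A \<and> (\<forall>B. B \<subset> A \<longrightarrow> monomial_ideal_of n B \<noteq> I)"

text \<open>The residuals \<open>m\<^sub>i / gcd (m\<^sub>k, m\<^sub>i)\<close>, \<open>k < i\<close>; the quotient is a difference of exponent
  vectors, which does not truncate by lemma \<open>expo_gcd_add_diff\<close>.\<close>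

definition Res :: "expo list \<Rightarrow> nat \<Rightarrow> expo set" where
  "Res ms i = {ms ! i - expo_gcd (ms ! k) (ms ! i) | k. k < i}"

definition linear_residuals :: "nat \<Rightarrow> 'k::field mpoly set \<Rightarrow> bool" where
  "linear_residuals n I \<longleftrightarrow>
     (\<exists>ms. distinct ms \<and> minimal_monomial_generators n I (set ms) \<and>
        (\<forall>i. 1 \<le> i \<and> i < length ms \<longrightarrow>
           (\<exists>L. minimal_monomial_generators n (monomial_ideal_of n (Res ms i) :: 'k mpoly set) L \<and>
                (\<forall>u\<in>L. expo_degree u = 1))))"

end

theory Submission
  imports Defs
begin

text \<open>For an ordering \<open>F\<^sub>1, \<dots>, F\<^sub>s\<close> of the facets, with square-free monomials \<open>m\<^sub>1, \<dots>, m\<^sub>s\<close>, both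
  conditions are inclusion statements about the sets \<open>F\<^sub>j - F\<^sub>k\<close>, \<open>k < j\<close>.

  On the combinatorial side, the faces of \<open>\<langle>F\<^sub>1, \<dots>, F\<^sub>j\<^sub>-\<^sub>1\<rangle> \<inter> \<langle>F\<^sub>j\<rangle>\<close> are the subsets of the
  intersections \<open>F\<^sub>k \<inter> F\<^sub>j\<close>.  Complementation in \<open>F\<^sub>j\<close> reverses inclusion, so the facets are the
  complements of the minimal sets among the \<open>F\<^sub>j - F\<^sub>k\<close> (\<open>facets_generated_complex_Int\<close>), and the
  complex is pure of dimension \<open>dim F\<^sub>j - 1\<close> iff each of those minimal sets is a singleton.

  On the algebraic side, a monomial lies in a monomial ideal iff some generator divides it
  (\<open>monomial_in_monomial_ideal_iff\<close>).  Hence the minimal monomial generators are exactly the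
  elements of any monomial generating set that are minimal under divisibility
  (\<open>minimal_monomial_generators_iff\<close>).  For square-free monomials divisibility is inclusion of
  supports, and the residual \<open>m\<^sub>j / gcd (m\<^sub>k, m\<^sub>j)\<close> is the square-free monomial with support
  \<open>F\<^sub>j - F\<^sub>k\<close>.  So the residuals of \<open>m\<^sub>j\<close> generate an ideal with linear minimal generators iff every
  minimal set among the \<open>F\<^sub>j - F\<^sub>k\<close> is a singleton.

  The facets are pairwise incomparable, so the minimal monomial generators of the facet ideal are
  the monomials of the facets, and orderings of generators correspond to orderings of facets.\<close>

section \<open>Divisibility of monomials\<close>

text \<open>Divisibility of monomials, stated on exponent vectors.\<close>

definition expo_dvd :: "expo \<Rightarrow> expo \<Rightarrow> bool" where
  "expo_dvd a b \<longleftrightarrow> (\<forall>i. Poly_Mapping.lookup a i \<le> Poly_Mapping.lookup b i)"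

lemma expo_dvd_refl: "expo_dvd a a"
  by (simp add: expo_dvd_def)

lemma expo_dvd_trans: "expo_dvd a b \<Longrightarrow> expo_dvd b c \<Longrightarrow> expo_dvd a c"
  unfolding expo_dvd_def by (meson order_trans)

lemma expo_dvd_antisym: "expo_dvd a b \<Longrightarrow> expo_dvd b a \<Longrightarrow> a = b"
  by (simp add: expo_dvd_def order_antisym poly_mapping_eqI)

lemma expo_dvd_add: "expo_dvd a b \<Longrightarrow> expo_dvd a (c + b)"
  by (simp add: expo_dvd_def lookup_add trans_le_add2)

lemma expo_dvd_diff_add: "expo_dvd a b \<Longrightarrow> (b - a) + a = b"
  by (rule poly_mapping_eqI) (simp add: expo_dvd_def lookup_add lookup_minus)

lemma expo_degree_less:
  assumes "expo_dvd a b" "a \<noteq> b"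
  shows "expo_degree a < expo_degree b"
proof -
  have sub: "Poly_Mapping.keys a \<subseteq> Poly_Mapping.keys b"
  proof
    fix i assume "i \<in> Poly_Mapping.keys a"
    moreover have "Poly_Mapping.lookup a i \<le> Poly_Mapping.lookup b i"
      using assms(1) by (simp add: expo_dvd_def)
    ultimately show "i \<in> Poly_Mapping.keys b"
      by (simp add: in_keys_iff)
  qed
  have "expo_degree a = (\<Sum>i\<in>Poly_Mapping.keys b. Poly_Mapping.lookup a i)"
    unfolding expo_degree_def using sub
    by (intro sum.mono_neutral_left) (auto simp: in_keys_iff)
  also have "\<dots> < expo_degree b"
    unfolding expo_degree_def
  proof (rule sum_strict_mono_ex1)
    obtain i where "Poly_Mapping.lookup a i \<noteq> Poly_Mapping.lookup b i"
      using assms(2) by (meson poly_mapping_eqI)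
    then have "Poly_Mapping.lookup a i < Poly_Mapping.lookup b i"
      using assms(1) by (simp add: expo_dvd_def order.not_eq_order_implies_strict)
    then show "\<exists>i\<in>Poly_Mapping.keys b. Poly_Mapping.lookup a i < Poly_Mapping.lookup b i"
      by (intro bexI[of _ i]) (auto simp: in_keys_iff)
  qed (use assms(1) in \<open>auto simp: expo_dvd_def\<close>)
  finally show ?thesis .
qed

text \<open>The members of a set of monomials that are minimal under divisibility.\<close>

definition min_expos :: "expo set \<Rightarrow> expo set" where
  "min_expos A = {a \<in> A. \<forall>b\<in>A. expo_dvd b a \<longrightarrow> b = a}"

lemma ex_min_expos_dvd:
  assumes "a \<in> A"
  shows "\<exists>b\<in>min_expos A. expo_dvd b a"
  using assms
proof (induction "expo_degree a" arbitrary: a rule: less_induct)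
  case less
  show ?case
  proof (cases "a \<in> min_expos A")
    case True
    then show ?thesis using expo_dvd_refl by blast
  next
    case False
    then obtain b where "b \<in> A" "expo_dvd b a" "b \<noteq> a"
      using less.prems by (auto simp: min_expos_def)
    then show ?thesis
      using less.hyps[of b] expo_degree_less expo_dvd_trans by blast
  qed
qed

section \<open>Monomial ideals\<close>

lemma monomial_in_carrier_iff:
  "(monomial a :: 'k::field mpoly) \<in> carrier (poly_ring n) \<longleftrightarrow> a \<in> expos n"
  by (simp add: monomial_def poly_ring_def)

lemma ring_poly_ring: "ring (poly_ring n :: 'k::field mpoly ring)"
  using cring_poly_ring by (rule cring.axioms(1))

text \<open>The polynomials all of whose monomials are multiples of members of \<open>A\<close> form an ideal; as it
  contains \<open>A\<close>, it bounds the ideal generated by \<open>A\<close> from above.\<close>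

lemma ideal_multiples:
  "ideal {p. \<forall>a\<in>Poly_Mapping.keys p. a \<in> expos n \<and> (\<exists>b\<in>A. expo_dvd b a)}
     (poly_ring n :: 'k::field mpoly ring)"
  (is "ideal ?J ?R")
proof -
  interpret R: cring ?R by (rule cring_poly_ring)
  have carrier: "?J \<subseteq> carrier ?R"
    by (auto simp: poly_ring_def)
  have add: "p + q \<in> ?J" if "p \<in> ?J" "q \<in> ?J" for p q
    using that keys_add[of p q] by blast
  have minus: "\<ominus>\<^bsub>?R\<^esub> p = - p" if "p \<in> carrier ?R" for p
    using that by (intro R.minus_equality) (auto simp: poly_ring_def in_keys_iff)
  have mult: "q * p \<in> ?J" if p: "p \<in> ?J" and q: "q \<in> carrier ?R" for p q
  proof
    show "\<forall>a\<in>Poly_Mapping.keys (q * p). a \<in> expos n \<and> (\<exists>b\<in>A. expo_dvd b a)"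
    proof
      fix a assume a: "a \<in> Poly_Mapping.keys (q * p)"
      then obtain c e where ce: "a = c + e" "c \<in> Poly_Mapping.keys q" "e \<in> Poly_Mapping.keys p"
        using keys_mult[of q p] by blast
      have "q * p \<in> carrier ?R"
        using R.m_closed[of q p] p q carrier by (auto simp: poly_ring_def)
      with a have "a \<in> expos n"
        by (auto simp: poly_ring_def)
      moreover obtain b where "b \<in> A" "expo_dvd b e"
        using p ce(3) by blast
      ultimately show "a \<in> expos n \<and> (\<exists>b\<in>A. expo_dvd b a)"
        using expo_dvd_add ce(1) by blast
    qed
  qed
  show ?thesis
  proof (rule idealI)
    show "ring ?R" by (rule ring_poly_ring)
    show "subgroup ?J (add_monoid ?R)"
    proof (rule R.add.subgroupI)
      have "0 \<in> ?J" by simp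
      then show "?J \<noteq> {}" by (rule ex_in_conv[THEN iffD1, OF exI])
      show "\<ominus>\<^bsub>?R\<^esub> p \<in> ?J" if "p \<in> ?J" for p
        using that carrier minus[of p] by (auto simp: in_keys_iff)
      show "p \<oplus>\<^bsub>?R\<^esub> q \<in> ?J" if "p \<in> ?J" "q \<in> ?J" for p q
        using add[OF that] by (simp add: poly_ring_def)
    qed (use carrier in auto)
    show "q \<otimes>\<^bsub>?R\<^esub> p \<in> ?J" "p \<otimes>\<^bsub>?R\<^esub> q \<in> ?J" if "p \<in> ?J" "q \<in> carrier ?R" for p q
      using mult[OF that] by (simp_all add: poly_ring_def mult.commute)
  qed
qed

lemma ideal_monomial_ideal_of:
  assumes "A \<subseteq> expos n"
  shows "ideal (monomial_ideal_of n A :: 'k::field mpoly set) (poly_ring n)"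
  unfolding monomial_ideal_of_def
  using assms by (intro ring.genideal_ideal ring_poly_ring) (auto simp: monomial_in_carrier_iff)

lemma monomial_in_monomial_ideal_iff:
  assumes A: "A \<subseteq> expos n" and a: "a \<in> expos n"
  shows "(monomial a :: 'k::field mpoly) \<in> monomial_ideal_of n A \<longleftrightarrow> (\<exists>b\<in>A. expo_dvd b a)"
proof
  let ?J = "{p :: 'k mpoly. \<forall>a\<in>Poly_Mapping.keys p. a \<in> expos n \<and> (\<exists>b\<in>A. expo_dvd b a)}"
  assume "(monomial a :: 'k mpoly) \<in> monomial_ideal_of n A"
  moreover have "monomial_ideal_of n A \<subseteq> ?J"
    unfolding monomial_ideal_of_def using A
    by (intro ring.genideal_minimal ring_poly_ring ideal_multiples)
       (auto simp: monomial_def intro: expo_dvd_refl)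
  ultimately have "(monomial a :: 'k mpoly) \<in> ?J"
    by blast
  then show "\<exists>b\<in>A. expo_dvd b a"
    by (simp add: monomial_def)
next
  assume "\<exists>b\<in>A. expo_dvd b a"
  then obtain b where b: "b \<in> A" "expo_dvd b a" by blast
  have "a - b \<in> expos n"
    using a by (auto simp: expos_def in_keys_iff lookup_minus subset_iff)
  then have diff: "(monomial (a - b) :: 'k mpoly) \<in> carrier (poly_ring n)"
    by (simp add: monomial_in_carrier_iff)
  have "(monomial b :: 'k mpoly) \<in> monomial_ideal_of n A"
    unfolding monomial_ideal_of_def
  proof (rule subsetD[OF ring.genideal_self[OF ring_poly_ring]])
    show "monomial ` A \<subseteq> carrier (poly_ring n :: 'k mpoly ring)"
      using A by (auto simp: monomial_in_carrier_iff)
  qed (use b(1) in blast)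
  from ideal.I_l_closed[OF ideal_monomial_ideal_of[OF A] this diff]
  have "monomial (a - b) * (monomial b :: 'k mpoly) \<in> monomial_ideal_of n A"
    by (simp add: poly_ring_def)
  then show "(monomial a :: 'k mpoly) \<in> monomial_ideal_of n A"
    by (simp add: monomial_add[symmetric] expo_dvd_diff_add[OF b(2)])
qed

lemma monomial_ideal_subset_iff:
  assumes A: "A \<subseteq> expos n" and B: "B \<subseteq> expos n"
  shows "(monomial_ideal_of n A :: 'k::field mpoly set) \<subseteq> monomial_ideal_of n B
         \<longleftrightarrow> (\<forall>a\<in>A. \<exists>b\<in>B. expo_dvd b a)"
proof -
  have "(monomial_ideal_of n A :: 'k mpoly set) \<subseteq> monomial_ideal_of n B
        \<longleftrightarrow> monomial ` A \<subseteq> (monomial_ideal_of n B :: 'k mpoly set)"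
    unfolding monomial_ideal_of_def[of n A]
    using A by (intro ring.Idl_subset_ideal ring_poly_ring ideal_monomial_ideal_of B)
       (auto simp: monomial_in_carrier_iff)
  also have "\<dots> \<longleftrightarrow> (\<forall>a\<in>A. \<exists>b\<in>B. expo_dvd b a)"
    using A by (auto simp: monomial_in_monomial_ideal_iff[OF B] subset_iff)
  finally show ?thesis .
qed

lemma monomial_ideal_eq_iff:
  assumes "A \<subseteq> expos n" "B \<subseteq> expos n"
  shows "(monomial_ideal_of n A :: 'k::field mpoly set) = monomial_ideal_of n B
         \<longleftrightarrow> (\<forall>a\<in>A. \<exists>b\<in>B. expo_dvd b a) \<and> (\<forall>b\<in>B. \<exists>a\<in>A. expo_dvd a b)"
  using assms monomial_ideal_subset_iff[of A n B, where 'k = 'k]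
    monomial_ideal_subset_iff[of B n A, where 'k = 'k] by blast

text \<open>The minimal monomial generators exist, are unique, and can be read off from any generating
  set of monomials.\<close>

lemma minimal_monomial_generators_iff:
  assumes B: "B \<subseteq> expos n"
  shows "minimal_monomial_generators n (monomial_ideal_of n B :: 'k::field mpoly set) A
         \<longleftrightarrow> A = min_expos B"
proof
  assume min: "minimal_monomial_generators n (monomial_ideal_of n B :: 'k mpoly set) A"
  then have A: "A \<subseteq> expos n"
    and eq: "(monomial_ideal_of n A :: 'k mpoly set) = monomial_ideal_of n B"
    by (auto simp: minimal_monomial_generators_def)
  then have AB: "\<exists>b\<in>B. expo_dvd b a" if "a \<in> A" for a
    using that monomial_ideal_eq_iff[OF A B, where 'k = 'k] by blast
  from eq have BA: "\<exists>a\<in>A. expo_dvd a b" if "b \<in> B" for b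
    using that monomial_ideal_eq_iff[OF A B, where 'k = 'k] by blast
  have antichain: "a = a'" if a: "a \<in> A" "a' \<in> A" "expo_dvd a a'" for a a'
  proof (rule ccontr)
    assume "a \<noteq> a'"
    \<comment> \<open>The multiple \<open>a'\<close> of \<open>a\<close> would be a redundant generator.\<close>
    then have "(monomial_ideal_of n (A - {a'}) :: 'k mpoly set) = monomial_ideal_of n A"
      using A a by (subst monomial_ideal_eq_iff) (auto intro: expo_dvd_refl)
    moreover have "A - {a'} \<subset> A" using a(2) by blast
    ultimately show False
      using min unfolding minimal_monomial_generators_def by metis
  qed
  have A_min: "a \<in> min_expos B" if a: "a \<in> A" for a
  proof -
    have minimal: "c = a" if c: "c \<in> B" "expo_dvd c a" for c
    proof -
      obtain a' where "a' \<in> A" "expo_dvd a' c" using BA[OF c(1)] by blast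
      then show ?thesis
        using antichain a c(2) expo_dvd_trans expo_dvd_antisym by metis
    qed
    then show ?thesis
      using AB[OF a] by (auto simp: min_expos_def)
  qed
  have "b \<in> A" if b: "b \<in> min_expos B" for b
  proof -
    obtain a where a: "a \<in> A" "expo_dvd a b"
      using BA[of b] b by (auto simp: min_expos_def)
    then have "a \<in> B" using A_min by (auto simp: min_expos_def)
    with a b show ?thesis by (auto simp: min_expos_def)
  qed
  with A_min show "A = min_expos B" by blast
next
  assume A: "A = min_expos B"
  have sub: "A \<subseteq> B" unfolding A min_expos_def by blast
  have eq: "(monomial_ideal_of n B :: 'k mpoly set) = monomial_ideal_of n A"
  proof (subst monomial_ideal_eq_iff)
    show "(\<forall>b\<in>B. \<exists>a\<in>A. expo_dvd a b) \<and> (\<forall>a\<in>A. \<exists>b\<in>B. expo_dvd b a)"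
      using sub ex_min_expos_dvd expo_dvd_refl unfolding A by blast
  qed (use sub B in auto)
  have "(monomial_ideal_of n C :: 'k mpoly set) \<noteq> monomial_ideal_of n B" if C: "C \<subset> A" for C
  proof
    assume "(monomial_ideal_of n C :: 'k mpoly set) = monomial_ideal_of n B"
    then have dvd: "\<exists>c\<in>C. expo_dvd c b" if "b \<in> B" for b
      using that C sub B monomial_ideal_eq_iff[of C n B, where 'k = 'k] by blast
    obtain a where a: "a \<in> A" "a \<notin> C" using C by blast
    then obtain c where "c \<in> C" "expo_dvd c a"
      using dvd[of a] sub by blast
    with a C show False by (auto simp: A min_expos_def)
  qed
  with eq sub B show "minimal_monomial_generators n (monomial_ideal_of n B :: 'k mpoly set) A"
    unfolding minimal_monomial_generators_def by blast
qed

section \<open>Square-free monomials\<close>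

text \<open>The exponent vector of the square-free monomial with support \<open>F\<close>, for finite \<open>F\<close>.\<close>

definition sqfree_expo :: "nat set \<Rightarrow> expo" where
  "sqfree_expo F = (\<Sum>i\<in>F. Poly_Mapping.single i 1)"

lemma lookup_sqfree_expo:
  assumes "finite F"
  shows "Poly_Mapping.lookup (sqfree_expo F) i = (if i \<in> F then 1 else 0)"
  using assms by (simp add: sqfree_expo_def lookup_sum lookup_single when_def)

lemma keys_sqfree_expo: "finite F \<Longrightarrow> Poly_Mapping.keys (sqfree_expo F) = F"
  by (auto simp: in_keys_iff lookup_sqfree_expo split: if_splits)

lemma expo_degree_sqfree_expo: "finite F \<Longrightarrow> expo_degree (sqfree_expo F) = card F"
  by (simp add: expo_degree_def keys_sqfree_expo lookup_sqfree_expo)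

lemma sqfree_expo_in_expos: "F \<subseteq> {1..n} \<Longrightarrow> sqfree_expo F \<in> expos n"
  using finite_subset[of F "{1..n}"] by (simp add: expos_def keys_sqfree_expo)

lemma expo_dvd_sqfree_expo_iff:
  "finite F \<Longrightarrow> finite G \<Longrightarrow> expo_dvd (sqfree_expo F) (sqfree_expo G) \<longleftrightarrow> F \<subseteq> G"
  by (auto simp: expo_dvd_def lookup_sqfree_expo)

lemma sqfree_expo_eq_iff:
  "finite F \<Longrightarrow> finite G \<Longrightarrow> sqfree_expo F = sqfree_expo G \<longleftrightarrow> F = G"
  by (metis keys_sqfree_expo)

lemma prod_var_eq_monomial:
  "finite F \<Longrightarrow> (\<Prod>i\<in>F. var i :: 'k::field mpoly) = monomial (sqfree_expo F)"
  by (induction F rule: finite_induct)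
     (simp_all add: sqfree_expo_def var_def monomial_add, simp add: monomial_def)

lemma sqfree_expo_residual:
  assumes "finite F" "finite G"
  shows "sqfree_expo F - expo_gcd (sqfree_expo G) (sqfree_expo F) = sqfree_expo (F - G)"
  using assms
  by (intro poly_mapping_eqI) (simp add: lookup_minus expo_gcd.rep_eq lookup_sqfree_expo)

text \<open>The inclusion-minimal members of a family of sets.\<close>

definition min_sets :: "nat set set \<Rightarrow> nat set set" where
  "min_sets A = {D \<in> A. \<forall>E\<in>A. E \<subseteq> D \<longrightarrow> E = D}"

lemma min_expos_sqfree_expo:
  assumes "\<And>F. F \<in> A \<Longrightarrow> finite F"
  shows "min_expos (sqfree_expo ` A) = sqfree_expo ` min_sets A"
  using assms
  by (auto simp: min_expos_def min_sets_def expo_dvd_sqfree_expo_iff sqfree_expo_eq_iff)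

section \<open>Shelling steps\<close>

lemma facets_generated_complex_Int:
  "facets (generated_complex A \<inter> generated_complex {F}) = (\<lambda>D. F - D) ` min_sets ((\<lambda>G. F - G) ` A)"
  (is "facets ?C = _")
proof -
  have face: "H \<in> ?C \<longleftrightarrow> (\<exists>G\<in>A. H \<subseteq> G \<inter> F)" for H
    by (auto simp: generated_complex_def)
  show ?thesis
  proof (intro equalityI subsetI)
    fix H assume H: "H \<in> facets ?C"
    then have "H \<in> ?C" by (simp add: facets_def)
    then obtain G where G: "G \<in> A" "H \<subseteq> G \<inter> F"
      using face[of H] by blast
    have max: "G' \<inter> F = H" if "G' \<in> A" "H \<subseteq> G' \<inter> F" for G'
    proof -
      have "G' \<inter> F \<in> ?C" using face[of "G' \<inter> F"] that(1) by blast
      with H that(2) show ?thesis unfolding facets_def by blast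
    qed
    have "F - G \<in> min_sets ((\<lambda>G. F - G) ` A)"
      unfolding min_sets_def
    proof (intro CollectI conjI ballI impI)
      fix E assume "E \<in> (\<lambda>G. F - G) ` A" "E \<subseteq> F - G"
      then obtain G' where G': "G' \<in> A" "E = F - G'" "F - G' \<subseteq> F - G" by blast
      with G(2) have "G' \<inter> F = H" by (intro max) auto
      with max[OF G] G'(2) show "E = F - G" by blast
    qed (use G in blast)
    moreover have "H = F - (F - G)" using max[OF G] by blast
    ultimately show "H \<in> (\<lambda>D. F - D) ` min_sets ((\<lambda>G. F - G) ` A)" by blast
  next
    fix H assume "H \<in> (\<lambda>D. F - D) ` min_sets ((\<lambda>G. F - G) ` A)"
    then obtain G where G: "G \<in> A" "H = G \<inter> F"
      and min: "\<And>G'. G' \<in> A \<Longrightarrow> F - G' \<subseteq> F - G \<Longrightarrow> F - G' = F - G"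
      by (auto simp: min_sets_def)
    have "K = H" if K: "K \<in> ?C" "H \<subseteq> K" for K
    proof -
      obtain G' where G': "G' \<in> A" "K \<subseteq> G' \<inter> F" using K(1) face[of K] by blast
      have "F - G' = F - G" using G' G(2) K(2) by (intro min) auto
      with G' G(2) K(2) show ?thesis by blast
    qed
    moreover have "H \<in> ?C" using face[of H] G by blast
    ultimately show "H \<in> facets ?C" unfolding facets_def by blast
  qed
qed

lemma pure_shelling_step_iff:
  assumes "finite F"
  shows "pure_of_dim (face_dim F - 1) (generated_complex A \<inter> generated_complex {F})
         \<longleftrightarrow> (\<forall>D\<in>min_sets ((\<lambda>G. F - G) ` A). card D = 1)"
proof -
  have "face_dim (F - D) = face_dim F - 1 \<longleftrightarrow> card D = 1"
    if "D \<in> min_sets ((\<lambda>G. F - G) ` A)" for D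
  proof -
    have "D \<subseteq> F" using that by (auto simp: min_sets_def)
    then have "card (F - D) = card F - card D" "card D \<le> card F"
      using assms by (auto simp: card_Diff_subset finite_subset card_mono)
    then show ?thesis by (auto simp: face_dim_def)
  qed
  then show ?thesis
    by (simp add: pure_of_dim_def facets_generated_complex_Int)
qed

lemma linear_residual_step_iff:
  assumes Fs: "\<And>F. F \<in> set Fs \<Longrightarrow> F \<subseteq> {1..n}" and j: "j < length Fs"
  shows "(\<exists>L. minimal_monomial_generators n
            (monomial_ideal_of n (Res (map sqfree_expo Fs) j) :: 'k::field mpoly set) L
            \<and> (\<forall>u\<in>L. expo_degree u = 1))
         \<longleftrightarrow> (\<forall>D\<in>min_sets ((\<lambda>G. Fs ! j - G) ` set (take j Fs)). card D = 1)"
proof -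
  let ?A = "(\<lambda>G. Fs ! j - G) ` set (take j Fs)"
  have fin: "finite F" if "F \<in> set Fs" for F
    using Fs[OF that] finite_subset by blast
  have "Res (map sqfree_expo Fs) j = (\<lambda>k. sqfree_expo (Fs ! j - Fs ! k)) ` {..<j}"
    unfolding Res_def setcompr_eq_image lessThan_def
    using j fin by (intro image_cong refl) (simp add: sqfree_expo_residual)
  also have "\<dots> = sqfree_expo ` ?A"
    using j by (simp add: nth_image[symmetric] image_image lessThan_atLeast0)
  finally have Res: "Res (map sqfree_expo Fs) j = sqfree_expo ` ?A" .
  have sub: "D \<subseteq> {1..n}" if "D \<in> ?A" for D
    using that Fs[of "Fs ! j"] j by auto
  then have expos: "sqfree_expo ` ?A \<subseteq> expos n"
    by (intro image_subsetI sqfree_expo_in_expos)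
  have finA: "finite D" if "D \<in> ?A" for D
    using sub[OF that] finite_subset by blast
  have min: "min_expos (sqfree_expo ` ?A) = sqfree_expo ` min_sets ?A"
    using finA by (rule min_expos_sqfree_expo)
  have "(\<exists>L. minimal_monomial_generators n
      (monomial_ideal_of n (Res (map sqfree_expo Fs) j) :: 'k mpoly set) L
      \<and> (\<forall>u\<in>L. expo_degree u = 1))
    \<longleftrightarrow> (\<forall>u\<in>sqfree_expo ` min_sets ?A. expo_degree u = 1)"
    unfolding Res minimal_monomial_generators_iff[OF expos] min
    by simp
  also have "\<dots> \<longleftrightarrow> (\<forall>D\<in>min_sets ?A. expo_degree (sqfree_expo D) = 1)"
    by (rule ball_simps(9))
  also have "\<dots> \<longleftrightarrow> (\<forall>D\<in>min_sets ?A. card D = 1)"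
    using finA by (intro ball_cong refl) (simp add: min_sets_def expo_degree_sqfree_expo)
  finally show ?thesis .
qed

section \<open>Shellability and linear residuals\<close>

lemma minimal_monomial_generators_facet_ideal_iff:
  assumes "\<And>F. F \<in> facets \<Delta> \<Longrightarrow> F \<subseteq> {1..n}"
  shows "minimal_monomial_generators n (facet_ideal n \<Delta> :: 'k::field mpoly set) A
         \<longleftrightarrow> A = sqfree_expo ` facets \<Delta>"
proof -
  have fin: "finite F" if "F \<in> facets \<Delta>" for F
    using assms[OF that] finite_subset by blast
  have "facet_ideal n \<Delta> = (monomial_ideal_of n (sqfree_expo ` facets \<Delta>) :: 'k mpoly set)"
    unfolding facet_ideal_def monomial_ideal_of_def image_image
    using fin by (simp add: prod_var_eq_monomial cong: image_cong)
  moreover have "min_sets (facets \<Delta>) = facets \<Delta>"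
    by (auto simp: min_sets_def facets_def)
  moreover have "sqfree_expo ` facets \<Delta> \<subseteq> expos n"
    using assms sqfree_expo_in_expos by blast
  ultimately show ?thesis
    using fin by (simp add: minimal_monomial_generators_iff min_expos_sqfree_expo)
qed

theorem theorem3p3:
  fixes n :: nat and d :: int and \<Delta> :: "nat set set"
  assumes "infinite (UNIV :: 'k::field set)"
    and "simplicial_complex_on n \<Delta>"
    and "complex_dim \<Delta> = d"
  shows "shellable \<Delta> \<longleftrightarrow> linear_residuals n (facet_ideal n \<Delta> :: 'k mpoly set)"
proof -
  have sub: "F \<subseteq> {1..n}" if "F \<in> facets \<Delta>" for F
    using assms(2) that by (auto simp: simplicial_complex_on_def facets_def)
  then have fin: "finite F" if "F \<in> facets \<Delta>" for F
    using that finite_subset by blast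
  have inj: "inj_on sqfree_expo (facets \<Delta>)"
    using fin by (auto intro!: inj_onI simp: sqfree_expo_eq_iff)
  let ?steps = "\<lambda>Fs. \<forall>j. 1 \<le> j \<and> j < length Fs \<longrightarrow>
    (\<forall>D\<in>min_sets ((\<lambda>G. Fs ! j - G) ` set (take j Fs)). card D = 1)"
  let ?linear = "\<lambda>ms. \<forall>i. 1 \<le> i \<and> i < length ms \<longrightarrow>
    (\<exists>L. minimal_monomial_generators n (monomial_ideal_of n (Res ms i) :: 'k mpoly set) L \<and>
      (\<forall>u\<in>L. expo_degree u = 1))"
  have linear: "?linear (map sqfree_expo Fs) \<longleftrightarrow> ?steps Fs" if "set Fs = facets \<Delta>" for Fs
    using linear_residual_step_iff[of Fs n, where 'k = 'k] sub that
    by (metis (no_types, lifting) length_map)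
  have orderings: "(\<exists>ms. distinct ms \<and> set ms = sqfree_expo ` facets \<Delta> \<and> P ms)
    \<longleftrightarrow> (\<exists>Fs. distinct Fs \<and> set Fs = facets \<Delta> \<and> P (map sqfree_expo Fs))" for P
  proof
    assume "\<exists>ms. distinct ms \<and> set ms = sqfree_expo ` facets \<Delta> \<and> P ms"
    then obtain ms where ms: "distinct ms" "set ms = sqfree_expo ` facets \<Delta>" "P ms" by blast
    let ?Fs = "map (inv_into (facets \<Delta>) sqfree_expo) ms"
    have "map sqfree_expo ?Fs = ms"
      using ms(2) by (auto simp: f_inv_into_f intro!: map_idI)
    moreover have "distinct ?Fs"
      using ms(1,2) by (simp add: distinct_map inj_on_inv_into)
    moreover have "set ?Fs = facets \<Delta>"
      using inj ms(2) by simp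
    ultimately show "\<exists>Fs. distinct Fs \<and> set Fs = facets \<Delta> \<and> P (map sqfree_expo Fs)"
      using ms(3) by metis
  next
    assume "\<exists>Fs. distinct Fs \<and> set Fs = facets \<Delta> \<and> P (map sqfree_expo Fs)"
    then show "\<exists>ms. distinct ms \<and> set ms = sqfree_expo ` facets \<Delta> \<and> P ms"
      using inj by (metis distinct_map set_map)
  qed
  have "shellable \<Delta> \<longleftrightarrow> (\<exists>Fs. distinct Fs \<and> set Fs = facets \<Delta> \<and> ?steps Fs)"
    unfolding shellable_def using fin
    by (intro ex_cong1 conj_cong refl) (metis nth_mem pure_shelling_step_iff)
  also have "\<dots> \<longleftrightarrow> (\<exists>Fs. distinct Fs \<and> set Fs = facets \<Delta> \<and> ?linear (map sqfree_expo Fs))"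
    using linear by (intro ex_cong1 conj_cong refl) blast
  also have "\<dots> \<longleftrightarrow> (\<exists>ms. distinct ms \<and> set ms = sqfree_expo ` facets \<Delta> \<and> ?linear ms)"
    by (rule orderings[symmetric])
  also have "\<dots> \<longleftrightarrow> linear_residuals n (facet_ideal n \<Delta> :: 'k mpoly set)"
    unfolding linear_residuals_def
    using minimal_monomial_generators_facet_ideal_iff[OF sub, where 'k = 'k] by simp
  finally show ?thesis .
qed

end
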